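(* $\mathcal{S}_\omega^+\to(\omega,\mathcal{S}_\omega^+)^2_2$; that is, for every $A\in\mathcal{S}^+_\omega$ and every coloring $c:[A]^2\to 2$ there is an infinite $B\subseteq A$ with $c[[B]^2]=\{0\}$, or there is $B\subseteq A$ with $B\in\mathcal{S}^+_\omega$ and $c[[B]^2]=\{1\}$.
   Context: Equip the Cantor space $2^\omega$ with the Haar (product) measure $\mu$. Let $\Omega$ be the countable set of clopen subsets of $2^\omega$ of measure $\frac12$, and for $n\in\omega$ let $\Omega_n$ be the set of clopen subsets of $2^\omega$ of measure $\frac{1}{2^n}$. For $n\in\omega$ let $\mathcal{S}^+_n=\{A\subseteq\Omega: (\forall V\in\Omega_n)(\exists U\in A)(U\cap V=\emptyset)\}$, $\mathcal{S}^+_\omega=\bigcup_{n\in\omega}\mathcal{S}^+_n$, and $\mathcal{S}_\omega=\mathcal{P}(\Omega)\setminus\mathcal{S}^+_\omega$ (an ideal on $\Omega$ whose positive sets are $\mathcal{S}^+_\omega$). *)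

theory Defs
  imports "HOL-Probability.Probability" "HOL-Library.Ramsey"
begin

text \<open>
  The Cantor space is the type \<^typ>\<open>nat \<Rightarrow> bool\<close> with its library (product) topology.  The fair
  coin measure on each factor is uniform on the two points, so the product measure is the Haar
  measure of \<open>(\<int>/2)\<^sup>\<omega>\<close>.
\<close>

definition cantor_measure :: "(nat \<Rightarrow> bool) measure" where
  "cantor_measure = PiM UNIV (\<lambda>_. uniform_count_measure UNIV)"

definition clopens_of_measure :: "real \<Rightarrow> (nat \<Rightarrow> bool) set set" where
  "clopens_of_measure r = {U. open U \<and> closed U \<and> measure cantor_measure U = r}"

text \<open>Clopen sets are measurable, so no junk value of \<^const>\<open>measure\<close> enters \<^const>\<open>clopens_of_measure\<close>.\<close>

instance bool :: second_countable_topology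
proof
  have "open = generate_topology (UNIV :: bool set set)"
    by (auto simp: fun_eq_iff Topological_Spaces.open_discrete intro: generate_topology.Basis)
  then show "\<exists>B :: bool set set. countable B \<and> open = generate_topology B"
    by (intro exI[of _ UNIV]) (simp add: countable_finite)
qed

lemma sets_cantor_measure: "sets cantor_measure = sets borel"
proof -
  have "X \<in> sets borel" for X :: "bool set"
    by (rule borel_open[OF Topological_Spaces.open_discrete])
  then have bool: "sets (uniform_count_measure (UNIV :: bool set)) = sets borel"
    by (auto simp: sets_uniform_count_measure)
  have "sets cantor_measure = sets (PiM UNIV (\<lambda>_ :: nat. borel :: bool measure))"
    unfolding cantor_measure_def by (rule sets_PiM_cong) (simp_all only: bool)
  then show ?thesis
    using sets_PiM_equal_borel[where ?'a = nat and ?'b = bool] by simp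
qed

lemma clopens_of_measure_sets: "U \<in> clopens_of_measure r \<Longrightarrow> U \<in> sets cantor_measure"
  by (simp add: clopens_of_measure_def sets_cantor_measure borel_open)

definition \<Omega> :: "(nat \<Rightarrow> bool) set set" where
  "\<Omega> = clopens_of_measure (1 / 2)"

definition \<Omega>\<^sub>n :: "nat \<Rightarrow> (nat \<Rightarrow> bool) set set" where
  "\<Omega>\<^sub>n n = clopens_of_measure (1 / 2 ^ n)"

definition S_pos :: "nat \<Rightarrow> (nat \<Rightarrow> bool) set set set" where
  "S_pos n = {A. A \<subseteq> \<Omega> \<and> (\<forall>V\<in>\<Omega>\<^sub>n n. \<exists>U\<in>A. U \<inter> V = {})}"

definition S_pos_omega :: "(nat \<Rightarrow> bool) set set set" where
  "S_pos_omega = (\<Union>n. S_pos n)"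

end

theory Submission
  imports Defs
begin

text \<open>
  Removing a finite union of non-positive sets costs only one unit of the index: if \<open>A \<in> S_pos n\<close>
  and \<open>C\<close> is not positive, then \<open>A - C \<in> S_pos (Suc n)\<close>, however many pieces \<open>C\<close> is made of.  If
  every positive subset \<open>B\<close> of \<open>A\<close> has a point whose 0-neighbours in \<open>B\<close> form a positive set, iteration
  yields an infinite 0-homogeneous set.  Otherwise some positive \<open>B\<close> has only non-positive
  0-neighbourhoods; going through the countably many \<open>V \<in> \<Omega>\<^sub>n (Suc n)\<close> one greedily picks
  \<open>U \<in> B\<close> disjoint from \<open>V\<close> and outside the 0-neighbourhoods of the points picked before.
\<close>

section \<open>Cylinder sets given by finite prefixes\<close>

definition prefix_set :: "nat \<Rightarrow> (nat \<Rightarrow> bool) \<Rightarrow> nat set" where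
  "prefix_set N x = {i. i < N \<and> x i}"

lemma prefix_set_eq_iff: "prefix_set N x = prefix_set N y \<longleftrightarrow> (\<forall>i<N. x i = y i)"
  by (auto simp: prefix_set_def)

lemma prefix_set_Pow: "prefix_set N x \<in> Pow {..<N}"
  by (auto simp: prefix_set_def)

lemma prefix_set_mem: "s \<subseteq> {..<N} \<Longrightarrow> prefix_set N (\<lambda>i. i \<in> s) = s"
  by (auto simp: prefix_set_def)

lemma vimage_prefix_set_single:
  assumes "s \<subseteq> {..<N}"
  shows "prefix_set N -` {s} = {x. \<forall>i\<in>{..<N}. x i \<in> {i \<in> s}}"
proof -
  have "prefix_set N x = s \<longleftrightarrow> (\<forall>i<N. x i = (i \<in> s))" for x
    using prefix_set_eq_iff[of N x "\<lambda>i. i \<in> s"] by (simp add: prefix_set_mem[OF assms])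
  then show ?thesis
    by (simp add: vimage_def Ball_def)
qed

lemma open_vimage_prefix_set: "open (prefix_set N -` T)"
proof -
  have *: "open (prefix_set N -` {s})" if "s \<subseteq> {..<N}" for s
    unfolding vimage_prefix_set_single[OF that]
    using product_topology_basis'[of "{..<N}" "\<lambda>i. {i \<in> s}" "\<lambda>i. i"]
    by (simp add: Topological_Spaces.open_discrete)
  have "prefix_set N -` T = (\<Union>s\<in>T \<inter> Pow {..<N}. prefix_set N -` {s})"
    using prefix_set_Pow by auto
  then show ?thesis
    using * by auto
qed

lemma closed_vimage_prefix_set: "closed (prefix_set N -` T)"
  unfolding closed_def vimage_Compl[symmetric] by (rule open_vimage_prefix_set)

lemma sets_vimage_prefix_set: "prefix_set N -` T \<in> sets cantor_measure"
  by (simp add: sets_cantor_measure borel_open open_vimage_prefix_set)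

section \<open>Measure of cylinder sets\<close>

interpretation cantor: product_prob_space "\<lambda>_::nat. uniform_count_measure (UNIV :: bool set)" UNIV
  rewrites "PiM UNIV (\<lambda>_::nat. uniform_count_measure (UNIV :: bool set)) = cantor_measure"
proof -
  interpret prob_space "uniform_count_measure (UNIV :: bool set)"
    by (rule prob_space_uniform_count_measure) auto
  show "product_prob_space (\<lambda>_::nat. uniform_count_measure (UNIV :: bool set))"
    by unfold_locales
qed (simp add: cantor_measure_def)

lemma measure_vimage_prefix_set_single:
  assumes "s \<subseteq> {..<N}"
  shows "measure cantor_measure (prefix_set N -` {s}) = 1 / 2 ^ N"
proof -
  have "prefix_set N -` {s} =
      prod_emb UNIV (\<lambda>_. uniform_count_measure UNIV) {..<N} (PiE {..<N} (\<lambda>i. {i \<in> s}))"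
    unfolding vimage_prefix_set_single[OF assms]
    by (rule set_eqI) (simp add: prod_emb_def space_uniform_count_measure PiE_iff Ball_def)
  then show ?thesis
    using cantor.measure_PiM_emb[of "{..<N}" "\<lambda>i. {i \<in> s}"]
    by (simp add: sets_uniform_count_measure measure_uniform_count_measure power_one_over)
qed

text \<open>A prefix is coded by the set of positions where it is true, so the prefixes of length
  \<open>N\<close> are exactly \<open>Pow {..<N}\<close>. The cylinders over distinct prefixes are
  disjoint and have equal measure, so measuring becomes counting.\<close>

lemma measure_vimage_prefix_set:
  assumes "T \<subseteq> Pow {..<N}"
  shows "measure cantor_measure (prefix_set N -` T) = card T / 2 ^ N"
proof -
  have "finite T"
    using assms finite_subset by blast
  then have "measure cantor_measure (\<Union>s\<in>T. prefix_set N -` {s}) =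
      (\<Sum>s\<in>T. measure cantor_measure (prefix_set N -` {s}))"
    by (intro cantor.finite_measure_finite_Union)
      (auto simp: disjoint_family_on_def sets_vimage_prefix_set)
  also have "\<dots> = (\<Sum>s\<in>T. 1 / 2 ^ N)"
    using assms by (intro sum.cong refl measure_vimage_prefix_set_single) auto
  also have "(\<Union>s\<in>T. prefix_set N -` {s}) = prefix_set N -` T"
    by auto
  finally show ?thesis
    by simp
qed

section \<open>Clopen sets depend on finitely many coordinates\<close>

lemma open_contains_prefix_set:
  assumes "open W" and "x \<in> W"
  obtains N where "\<And>y. prefix_set N y = prefix_set N x \<Longrightarrow> y \<in> W"
proof -
  have "openin (product_topology (\<lambda>i::nat. euclidean :: bool topology) UNIV) W"
    using assms(1) by (simp add: euclidean_product_topology)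
  from product_topology_open_contains_basis[OF this assms(2)] obtain X
    where "x \<in> PiE UNIV X \<and> (\<forall>i. openin euclidean (X i)) \<and>
      finite {i. X i \<noteq> topspace euclidean} \<and> PiE UNIV X \<subseteq> W"
    by (rule exE)
  then have X: "x \<in> PiE UNIV X" "finite {i. X i \<noteq> UNIV}" "PiE UNIV X \<subseteq> W"
    by simp_all
  obtain N where N: "{i. X i \<noteq> UNIV} \<subseteq> {..<N}"
    using finite_nat_iff_bounded X(2) by blast
  have "y \<in> W" if "prefix_set N y = prefix_set N x" for y
  proof -
    have "y i \<in> X i" for i
    proof (cases "i < N")
      case True
      then show ?thesis
        using X(1) that by (auto simp: prefix_set_eq_iff PiE_iff)
    next
      case False
      then have "X i = UNIV"
        using N by auto
      then show ?thesis
        by simp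
    qed
    then show ?thesis
      using X(3) by auto
  qed
  then show ?thesis
    using that by blast
qed

lemma compact_cantor: "compact (UNIV :: (nat \<Rightarrow> bool) set)"
proof -
  have "compact_space (euclidean :: bool topology)"
    by (simp add: compact_space_def finite_imp_compact)
  then have "compact_space (product_topology (\<lambda>i::nat. euclidean :: bool topology) UNIV)"
    by (simp add: compact_space_product_topology)
  then show ?thesis
    by (simp add: euclidean_product_topology compact_space_def)
qed

text \<open>Around each point some cylinder decides membership in \<open>W\<close>; by compactness
  finitely many of these cover the space, and the longest prefix among them suffices. All larger
  \<open>M\<close> are included so that the depth can later be increased at will.\<close>

lemma clopen_eq_vimage_prefix_set:
  assumes "open W" and "closed W"
  shows "\<exists>N. \<forall>M\<ge>N. \<exists>T\<subseteq>Pow {..<M}. W = prefix_set M -` T"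
proof -
  have "\<exists>N. \<forall>y. prefix_set N y = prefix_set N x \<longrightarrow> (y \<in> W \<longleftrightarrow> x \<in> W)" for x
  proof (cases "x \<in> W")
    case True
    then show ?thesis
      using open_contains_prefix_set[OF assms(1)] by metis
  next
    case False
    then show ?thesis
      using open_contains_prefix_set[of "- W"] assms(2) by (metis ComplD ComplI open_Compl)
  qed
  then obtain n where n: "\<And>x y. prefix_set (n x) y = prefix_set (n x) x \<Longrightarrow> y \<in> W \<longleftrightarrow> x \<in> W"
    by metis
  obtain D where D: "finite D" "UNIV \<subseteq> (\<Union>x\<in>D. prefix_set (n x) -` {prefix_set (n x) x})"
    by (rule compactE_image[OF compact_cantor, of UNIV "\<lambda>x. prefix_set (n x) -` {prefix_set (n x) x}"])
      (auto intro: open_vimage_prefix_set)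
  obtain N where N: "\<And>x. x \<in> D \<Longrightarrow> n x \<le> N"
    using D(1) by (metis finite_imageI finite_nat_set_iff_bounded_le imageI)
  have "\<exists>T\<subseteq>Pow {..<M}. W = prefix_set M -` T" if "N \<le> M" for M
  proof (intro exI conjI)
    \<comment> \<open>The witness for \<open>T\<close> is the set of all prefixes of points of
      \<open>W\<close>.\<close>
    show "prefix_set M ` W \<subseteq> Pow {..<M}"
      using prefix_set_Pow by blast
    have "y \<in> W" if "z \<in> W" "prefix_set M y = prefix_set M z" for y z
    proof -
      obtain x where x: "x \<in> D" "prefix_set (n x) z = prefix_set (n x) x"
        using D(2) by auto
      then have "n x \<le> M"
        using N \<open>N \<le> M\<close> order_trans by blast
      then have "prefix_set (n x) y = prefix_set (n x) x"
        using x(2) that(2) by (auto simp: prefix_set_eq_iff)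
      then show ?thesis
        using n x(2) that(1) by blast
    qed
    then show "W = prefix_set M -` prefix_set M ` W"
      by auto
  qed
  then show ?thesis
    by auto
qed

lemma countable_clopens_of_measure: "countable (clopens_of_measure r)"
proof -
  have "clopens_of_measure r \<subseteq> (\<Union>N. (\<lambda>T. prefix_set N -` T) ` Pow (Pow {..<N}))"
  proof
    fix W assume "W \<in> clopens_of_measure r"
    then have "open W" "closed W"
      by (auto simp: clopens_of_measure_def)
    then obtain N where "\<exists>T\<subseteq>Pow {..<N}. W = prefix_set N -` T"
      using clopen_eq_vimage_prefix_set by (meson order_refl)
    then show "W \<in> (\<Union>N. (\<lambda>T. prefix_set N -` T) ` Pow (Pow {..<N}))"
      by blast
  qed
  then show ?thesis
    by (rule countable_subset) (auto intro: countable_finite)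
qed

text \<open>At depth \<open>N + n\<close> a set of measure \<open>1 / 2 ^ n\<close> consists of
  exactly \<open>2 ^ N\<close> cylinders. \<open>W\<close> uses at most that many, so cylinders can
  be added until the count is exact.\<close>

lemma clopen_subset_\<Omega>\<^sub>n:
  assumes "open W" and "closed W" and "measure cantor_measure W \<le> 1 / 2 ^ n"
  obtains V where "V \<in> \<Omega>\<^sub>n n" and "W \<subseteq> V"
proof -
  obtain N where "\<forall>M\<ge>N. \<exists>T\<subseteq>Pow {..<M}. W = prefix_set M -` T"
    using clopen_eq_vimage_prefix_set[OF assms(1,2)] by (rule exE)
  then have "\<exists>T\<subseteq>Pow {..<N + n}. W = prefix_set (N + n) -` T"
    by simp
  then obtain T where T: "T \<subseteq> Pow {..<N + n}" "W = prefix_set (N + n) -` T"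
    by blast
  then have "card T / 2 ^ (N + n) \<le> (1 / 2 ^ n :: real)"
    using assms(3) by (simp add: measure_vimage_prefix_set)
  then have "real (card T) \<le> 2 ^ N"
    by (simp add: power_add field_simps)
  then have "card T \<le> 2 ^ N"
    by (metis of_nat_le_iff of_nat_numeral of_nat_power)
  moreover have "2 ^ N \<le> card (Pow {..<N + n})"
    by (simp add: card_Pow)
  ultimately obtain T' where T': "T \<subseteq> T'" "T' \<subseteq> Pow {..<N + n}" "card T' = 2 ^ N"
    using exists_subset_between[of T "2 ^ N" "Pow {..<N + n}"] T(1) by auto
  then have "prefix_set (N + n) -` T' \<in> \<Omega>\<^sub>n n"
    by (simp add: \<Omega>\<^sub>n_def clopens_of_measure_def open_vimage_prefix_set closed_vimage_prefix_set
        measure_vimage_prefix_set power_add)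
  then show ?thesis
    using that T(2) T'(1) by blast
qed

lemma \<Omega>\<^sub>n_meets:
  obtains V where "V \<in> \<Omega>\<^sub>n n" and "x \<in> V"
proof -
  have "measure cantor_measure (prefix_set n -` {prefix_set n x}) \<le> 1 / 2 ^ n"
    using measure_vimage_prefix_set_single[of "prefix_set n x" n] prefix_set_Pow[of n x] by simp
  then obtain V where "V \<in> \<Omega>\<^sub>n n" "prefix_set n -` {prefix_set n x} \<subseteq> V"
    by (rule clopen_subset_\<Omega>\<^sub>n[OF open_vimage_prefix_set closed_vimage_prefix_set])
  then show ?thesis
    using that[of V] by auto
qed

section \<open>Positive sets and finite unions of non-positive sets\<close>

lemma S_posD: "B \<in> S_pos n \<Longrightarrow> V \<in> \<Omega>\<^sub>n n \<Longrightarrow> \<exists>U\<in>B. U \<inter> V = {}"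
  by (simp add: S_pos_def)

lemma S_pos_nonempty: "B \<in> S_pos n \<Longrightarrow> B \<noteq> {}"
  using \<Omega>\<^sub>n_meets[of n] by (fastforce simp: S_pos_def)

text \<open>A set \<open>U\<close> of measure one half has a point, and some \<open>V\<close> in
  \<open>\<Omega>\<^sub>n n\<close> contains it. This later ensures that a positive homogeneous set
  has at least one pair, so that its colour set is not empty.\<close>

lemma S_pos_not_singleton:
  assumes "B \<in> S_pos n"
  shows "B \<noteq> {U}"
proof
  assume B: "B = {U}"
  then have "measure cantor_measure U = 1 / 2"
    using assms by (auto simp: S_pos_def \<Omega>_def clopens_of_measure_def)
  then have "U \<noteq> {}"
    by auto
  then obtain x where "x \<in> U"
    by blast
  moreover obtain V where "V \<in> \<Omega>\<^sub>n n" "x \<in> V"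
    by (rule \<Omega>\<^sub>n_meets)
  ultimately show False
    using assms B by (auto simp: S_pos_def)
qed

text \<open>If \<open>V\<close> and \<open>W\<close> refute the two alternatives, then
  \<open>V \<union> W\<close> has measure at most \<open>2 / 2 ^ Suc n\<close> and so extends to
  some \<open>Z\<close> in \<open>\<Omega>\<^sub>n n\<close>. A member of
  \<open>X \<union> Y\<close> disjoint from \<open>Z\<close> would miss both \<open>V\<close> and
  \<open>W\<close>.\<close>

lemma S_pos_Un:
  assumes "X \<union> Y \<in> S_pos n"
  shows "X \<in> S_pos (Suc n) \<or> Y \<in> S_pos (Suc n)"
proof (rule ccontr)
  assume "\<not> ?thesis"
  then obtain V W where V: "V \<in> \<Omega>\<^sub>n (Suc n)" "\<And>U. U \<in> X \<Longrightarrow> U \<inter> V \<noteq> {}"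
    and W: "W \<in> \<Omega>\<^sub>n (Suc n)" "\<And>U. U \<in> Y \<Longrightarrow> U \<inter> W \<noteq> {}"
    using assms by (auto simp: S_pos_def)
  have VW: "V \<in> sets cantor_measure" "W \<in> sets cantor_measure"
    using V(1) W(1) clopens_of_measure_sets by (auto simp: \<Omega>\<^sub>n_def)
  have "measure cantor_measure (V \<union> W) \<le> measure cantor_measure V + measure cantor_measure W"
    using VW by (rule measure_Un_le)
  also have "\<dots> = 1 / 2 ^ n"
    using V(1) W(1) by (simp add: \<Omega>\<^sub>n_def clopens_of_measure_def)
  finally obtain Z where "Z \<in> \<Omega>\<^sub>n n" "V \<union> W \<subseteq> Z"
    using clopen_subset_\<Omega>\<^sub>n[of "V \<union> W" n] V(1) W(1)
    by (auto simp: \<Omega>\<^sub>n_def clopens_of_measure_def)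
  moreover from assms this(1) obtain U where "U \<in> X \<union> Y" "U \<inter> Z = {}"
    by (rule bexE[OF S_posD])
  ultimately show False
    using V(2)[of U] W(2)[of U] by blast
qed

text \<open>The index lost by \<open>S_pos_Un\<close> at each induction step is harmless, because a
  non-positive set fails \<open>S_pos\<close> at every index.\<close>

lemma S_pos_omega_Union:
  assumes "finite I" and "\<And>i. i \<in> I \<Longrightarrow> X i \<notin> S_pos_omega"
  shows "(\<Union>i\<in>I. X i) \<notin> S_pos_omega"
  using assms
proof (induction I rule: finite_induct)
  case empty
  then show ?case
    using S_pos_nonempty by (auto simp: S_pos_omega_def)
next
  case (insert i I)
  then show ?case
    using S_pos_Un[of "X i" "\<Union>i\<in>I. X i"] by (auto simp: S_pos_omega_def)
qed

lemma S_pos_Diff: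
  assumes "A \<in> S_pos n" and "C \<subseteq> A" and "C \<notin> S_pos_omega"
  shows "A - C \<in> S_pos (Suc n)"
  using S_pos_Un[of "A - C" C n] assms by (auto simp: S_pos_omega_def Un_absorb2)

section \<open>Construction of homogeneous sets\<close>

lemma image_nsets_2_range:
  fixes x :: "'i :: linorder \<Rightarrow> 'a"
  assumes "\<And>i j. i < j \<Longrightarrow> x i \<noteq> x j \<Longrightarrow> c {x i, x j} = k"
  shows "c ` [range x]\<^bsup>2\<^esup> \<subseteq> {k}"
proof
  fix v assume "v \<in> c ` [range x]\<^bsup>2\<^esup>"
  then obtain e where e: "e \<in> [range x]\<^bsup>2\<^esup>" "v = c e"
    by blast
  from e(1) obtain i j where ij: "e = {x i, x j}" "x i \<noteq> x j"
    by (elim nsets2_E) blast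
  have "c {x i, x j} = k"
    using assms[of i j] assms[of j i] ij(2) by (metis insert_commute neqE)
  then show "v \<in> {k}"
    using e(2) ij(1) by simp
qed

text \<open>\<open>P\<close> will be positivity. Repeatedly pick a point and shrink to its
  \<open>k\<close>-neighbours: every later point is then joined to it in colour \<open>k\<close> and
  differs from it.\<close>

lemma infinite_homogeneous:
  assumes "P A" and "\<And>B. B \<subseteq> A \<Longrightarrow> P B \<Longrightarrow> \<exists>x\<in>B. P {y \<in> B. y \<noteq> x \<and> c {x, y} = k}"
  obtains B where "B \<subseteq> A" and "infinite B" and "c ` [B]\<^bsup>2\<^esup> = {k}"
proof -
  have "\<forall>B. \<exists>x. B \<subseteq> A \<longrightarrow> P B \<longrightarrow> x \<in> B \<and> P {y \<in> B. y \<noteq> x \<and> c {x, y} = k}"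
    using assms(2) by meson
  from choice[OF this] obtain f
    where "\<forall>B. B \<subseteq> A \<longrightarrow> P B \<longrightarrow> f B \<in> B \<and> P {y \<in> B. y \<noteq> f B \<and> c {f B, y} = k}"
    by (rule exE)
  then have f: "f B \<in> B \<and> P {y \<in> B. y \<noteq> f B \<and> c {f B, y} = k}" if "B \<subseteq> A" "P B" for B
    using that by simp
  define next_set where "next_set B = {y \<in> B. y \<noteq> f B \<and> c {f B, y} = k}" for B
  define S where "S n = (next_set ^^ n) A" for n
  define x where "x n = f (S n)" for n
  have S_Suc: "S (Suc n) = {y \<in> S n. y \<noteq> x n \<and> c {x n, y} = k}" for n
    by (simp add: S_def x_def next_set_def)
  have S: "S n \<subseteq> A \<and> P (S n)" for n
  proof (induction n)
    case 0
    then show ?case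
      using assms(1) by (simp add: S_def)
  next
    case (Suc n)
    then show ?case
      using f[of "S n"] unfolding S_Suc x_def by auto
  qed
  have x_S: "x n \<in> S n" for n
    using S f by (simp add: x_def)
  have antimono: "S n \<subseteq> S m" if "m \<le> n" for m n
    using that by (rule lift_Suc_antimono_le[rotated]) (auto simp: S_Suc)
  have less: "x n \<noteq> x m \<and> c {x m, x n} = k" if "m < n" for m n
    using x_S[of n] antimono[of "Suc m" n] that by (auto simp: S_Suc)
  have "inj x"
    by (rule linorder_injI) (use less in force)
  have "infinite (range x)"
    using \<open>inj x\<close> by (rule range_inj_infinite)
  moreover have "range x \<subseteq> A"
    using x_S S by blast
  moreover have "c ` [range x]\<^bsup>2\<^esup> = {k}"
  proof
    show "c ` [range x]\<^bsup>2\<^esup> \<subseteq> {k}"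
      using less by (intro image_nsets_2_range) auto
    have "{x 0, x 1} \<in> [range x]\<^bsup>2\<^esup>"
      using less[of 0 1] by auto
    then show "{k} \<subseteq> c ` [range x]\<^bsup>2\<^esup>"
      using less[of 0 1] by force
  qed
  ultimately show ?thesis
    using that by blast
qed

lemma S_pos_homogeneous:
  assumes "A \<in> S_pos n" and small: "\<And>x. x \<in> A \<Longrightarrow> {y \<in> A. y \<noteq> x \<and> c {x, y} \<noteq> k} \<notin> S_pos_omega"
  obtains B where "B \<subseteq> A" and "B \<in> S_pos (Suc n)" and "c ` [B]\<^bsup>2\<^esup> = {k}"
proof -
  \<comment> \<open>The enumeration may repeat values; only its range matters.\<close>
  define V where "V = from_nat_into (\<Omega>\<^sub>n (Suc n))"
  have "\<Omega>\<^sub>n (Suc n) \<noteq> {}"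
    using \<Omega>\<^sub>n_meets by blast
  then have V: "range V = \<Omega>\<^sub>n (Suc n)"
    unfolding V_def \<Omega>\<^sub>n_def using countable_clopens_of_measure by (rule range_from_nat_into)
  define N where "N x = {y \<in> A. y \<noteq> x \<and> c {x, y} \<noteq> k}" for x
  \<comment> \<open>At stage \<open>j\<close> only finitely many sets \<open>N (U i)\<close> are
    forbidden. Their union is non-positive, so what remains of \<open>A\<close> is in
    \<open>S_pos (Suc n)\<close> for every \<open>j\<close>, and the same index serves all
    requirements \<open>V j\<close>.\<close>
  have "\<exists>U. \<forall>j. U j \<in> A - (\<Union>i<j. N (U i)) \<and> U j \<inter> V j = {}"
  proof (rule dependent_wellorder_choice)
    fix j and U :: "nat \<Rightarrow> (nat \<Rightarrow> bool) set"
    assume "\<And>i. i < j \<Longrightarrow> U i \<in> A - (\<Union>i'<i. N (U i')) \<and> U i \<inter> V i = {}"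
    then have "(\<Union>i<j. N (U i)) \<notin> S_pos_omega"
      using small by (intro S_pos_omega_Union) (auto simp: N_def)
    then have "A - (\<Union>i<j. N (U i)) \<in> S_pos (Suc n)"
      using assms(1) by (intro S_pos_Diff) (auto simp: N_def)
    moreover have "V j \<in> \<Omega>\<^sub>n (Suc n)"
      using V by blast
    ultimately show "\<exists>r. r \<in> A - (\<Union>i<j. N (U i)) \<and> r \<inter> V j = {}"
      using S_posD by blast
  qed auto
  then obtain U where U: "\<And>j. U j \<in> A" "\<And>i j. i < j \<Longrightarrow> U j \<notin> N (U i)" "\<And>j. U j \<inter> V j = {}"
    by auto
  have B: "range U \<in> S_pos (Suc n)"
    unfolding S_pos_def V[symmetric] using U(1,3) assms(1) by (auto simp: S_pos_def)
  \<comment> \<open>\<open>x\<close> itself is not in \<open>N x\<close>, so the sequence may repeat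
    points; hence the colour is claimed only for distinct values.\<close>
  have "c {U i, U j} = k" if "i < j" "U i \<noteq> U j" for i j
    using U(1)[of j] U(2)[OF that(1)] that(2) by (auto simp: N_def)
  then have "c ` [range U]\<^bsup>2\<^esup> \<subseteq> {k}"
    by (rule image_nsets_2_range)
  moreover have "\<exists>i. U i \<noteq> U 0"
    using S_pos_not_singleton[OF B, of "U 0"] by auto
  then have "[range U]\<^bsup>2\<^esup> \<noteq> {}"
    by (metis doubleton_in_nsets_2 empty_iff rangeI)
  ultimately have "c ` [range U]\<^bsup>2\<^esup> = {k}"
    by blast
  then show ?thesis
    using that B U(1) by blast
qed

theorem theorem3p1:
  fixes A :: "(nat \<Rightarrow> bool) set set" and c :: "(nat \<Rightarrow> bool) set set \<Rightarrow> nat"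
  assumes "A \<in> S_pos_omega" and "c \<in> [A]\<^bsup>2\<^esup> \<rightarrow> {0, 1}"
  shows "(\<exists>B. B \<subseteq> A \<and> infinite B \<and> c ` [B]\<^bsup>2\<^esup> = {0}) \<or>
         (\<exists>B. B \<subseteq> A \<and> B \<in> S_pos_omega \<and> c ` [B]\<^bsup>2\<^esup> = {1})"
proof (cases "\<forall>B\<subseteq>A. B \<in> S_pos_omega \<longrightarrow> (\<exists>x\<in>B. {y \<in> B. y \<noteq> x \<and> c {x, y} = 0} \<in> S_pos_omega)")
  case True
  obtain B where "B \<subseteq> A" "infinite B" "c ` [B]\<^bsup>2\<^esup> = {0}"
    by (rule infinite_homogeneous[of "\<lambda>B. B \<in> S_pos_omega" A c 0, OF assms(1)])
      (use True in blast)
  then show ?thesis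
    by blast
next
  case False
  \<comment> \<open>\<open>A'\<close> is a positive subset of \<open>A\<close> in which no point has
    a positive 0-neighbourhood.\<close>
  then obtain A' n where A': "A' \<subseteq> A" "A' \<in> S_pos n"
    and small: "\<And>x. x \<in> A' \<Longrightarrow> {y \<in> A'. y \<noteq> x \<and> c {x, y} = 0} \<notin> S_pos_omega"
    by (auto simp: S_pos_omega_def)
  have "{y \<in> A'. y \<noteq> x \<and> c {x, y} \<noteq> 1} \<notin> S_pos_omega" if "x \<in> A'" for x
  proof -
    \<comment> \<open>On pairs from \<open>A\<close> the only colour other than 1 is 0, which turns
      \<open>small\<close> into the hypothesis of \<open>S_pos_homogeneous\<close> for
      \<open>k = 1\<close>.\<close>
    have "c {x, y} \<in> {0, 1}" if "y \<in> A'" "y \<noteq> x" for y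
      using A'(1) \<open>x \<in> A'\<close> that by (intro funcset_mem[OF assms(2)]) auto
    then have "{y \<in> A'. y \<noteq> x \<and> c {x, y} \<noteq> 1} = {y \<in> A'. y \<noteq> x \<and> c {x, y} = 0}"
      by force
    then show ?thesis
      using small[OF that] by simp
  qed
  then obtain B where "B \<subseteq> A'" "B \<in> S_pos (Suc n)" "c ` [B]\<^bsup>2\<^esup> = {1}"
    by (rule S_pos_homogeneous[OF A'(2)])
  moreover from this have "B \<subseteq> A" "B \<in> S_pos_omega"
    using A'(1) by (auto simp: S_pos_omega_def)
  ultimately show ?thesis
    by blast
qed

end
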